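(* Let $G$ be a finite simple undirected graph and let $v_i$ be a vertex of $G$. Then $$\mathcal{E}_G(v_i)=\frac{1}{\pi}\int_{\mathbb{R}} \left(1- \frac{\mathbf{i}x\, \phi(G-v_i;\mathbf{i}x)}{\phi(G;\mathbf{i}x)}\right)dx.$$
   Context: Let $G$ have vertices $v_1,\dots,v_n$ and adjacency matrix $A=A(G)$, the symmetric $0/1$ matrix with $A_{ij}=1$ iff $v_i$ and $v_j$ are adjacent. The energy of the vertex $v_i$ is $\mathcal{E}_G(v_i)=|A|_{ii}$, the $i$-th diagonal entry of $|A|=(AA^* )^{1/2}$. $\phi(G;x)=\det(xI_n-A(G))$ is the characteristic polynomial of $G$ (the graph with no vertices has $\phi=1$). $G-v_i$ is the graph obtained from $G$ by removing $v_i$ and all edges containing it. $\mathbf{i}=\sqrt{-1}$. The integral is understood as a principal value, $\lim_{R\to\infty}\int_{-R}^{R}$; the integrand is considered for $x\neq 0$ (if $\phi(G;0)=0$ the singularity at $x=0$ is removable). *)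

theory Defs
  imports
    "HOL-Analysis.Analysis"
    "Jordan_Normal_Form.Schur_Decomposition"
    "Graph_Theory.Digraph"
begin

text \<open>A finite simple undirected graph is a graph in the sense of the \<open>graph\<close> locale of
  Graph_Theory: a finite, loop-free, symmetric digraph without parallel arcs, an undirected edge
  being a pair of opposite arcs. The list \<open>vs\<close> is the labelling \<open>v\<^sub>1,\<dots>,v\<^sub>n\<close> of the
  vertices that indexes the rows and columns of the adjacency matrix, counted from 0.\<close>

definition vertex_enum :: "('a, 'b) pre_digraph \<Rightarrow> 'a list \<Rightarrow> bool" where
  "vertex_enum G vs \<longleftrightarrow> distinct vs \<and> set vs = verts G"

definition adj_mat :: "('a, 'b) pre_digraph \<Rightarrow> 'a list \<Rightarrow> complex mat" where
  "adj_mat G vs = mat (length vs) (length vs)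
     (\<lambda>(i, j). if vs ! i \<rightarrow>\<^bsub>G\<^esub> vs ! j then 1 else 0)"

definition graph_char_poly :: "('a, 'b) pre_digraph \<Rightarrow> 'a list \<Rightarrow> complex poly" where
  "graph_char_poly G vs = char_poly (adj_mat G vs)"

text \<open>On \<open>complex\<close>, \<open>0 \<le> z\<close> means that \<open>z\<close> is real and nonnegative.\<close>

definition psd_mat :: "nat \<Rightarrow> complex mat \<Rightarrow> bool" where
  "psd_mat n B \<longleftrightarrow> B \<in> carrier_mat n n \<and> mat_adjoint B = B \<and>
     (\<forall>v \<in> carrier_vec n. 0 \<le> (B *\<^sub>v v) \<bullet>c v)"

text \<open>The square root of a positive semidefinite matrix \<open>M\<close> is its unique positive semidefinite
  square root; the value is unspecified if \<open>M\<close> is not positive semidefinite.\<close>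

definition psd_sqrt :: "complex mat \<Rightarrow> complex mat" where
  "psd_sqrt M = (THE B. psd_mat (dim_row M) B \<and> B * B = M)"

definition mat_abs :: "complex mat \<Rightarrow> complex mat" where
  "mat_abs A = psd_sqrt (A * mat_adjoint A)"

definition vertex_energy :: "('a, 'b) pre_digraph \<Rightarrow> 'a list \<Rightarrow> nat \<Rightarrow> complex" where
  "vertex_energy G vs i = mat_abs (adj_mat G vs) $$ (i, i)"

text \<open>Integrability is recorded separately, because the set integral of a
  non-integrable function and the limit of a divergent function are still terms of HOL.\<close>

definition pv_integrable :: "(real \<Rightarrow> complex) \<Rightarrow> bool" where
  "pv_integrable f \<longleftrightarrow> (\<forall>R > 0. set_integrable lborel {-R..R} f) \<and>
     (\<exists>I. ((\<lambda>R. LINT x:{-R..R}|lborel. f x) \<longlongrightarrow> I) at_top)"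

definition pv_integral :: "(real \<Rightarrow> complex) \<Rightarrow> complex" where
  "pv_integral f = Lim at_top (\<lambda>R. LINT x:{-R..R}|lborel. f x)"

end

theory Submission
  imports Defs "Jordan_Normal_Form.Spectral_Radius"
begin

text \<open>The adjacency matrix \<open>A\<close> is Hermitian, so \<open>A = U \<cdot> diag(l\<^sub>k) \<cdot> U\<^sup>*\<close> with \<open>U\<close> unitary and
  \<open>l\<^sub>k\<close> real, and every function of \<open>A\<close> is read off the same \<open>U\<close>. Put \<open>c\<^sub>k = |U\<^sub>i\<^sub>k|\<^sup>2\<close>; these
  weights sum to 1, since the rows of \<open>U\<close> are unit vectors. Both sides of the formula turn out to
  be \<open>\<Sum>\<^sub>k c\<^sub>k |l\<^sub>k|\<close>.

  On the left, \<open>U \<cdot> diag(|l\<^sub>k|) \<cdot> U\<^sup>*\<close> is positive semidefinite with square \<open>A A\<^sup>*\<close>. Positive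
  semidefinite square roots are unique, so it is \<open>|A|\<close>, and its \<open>i\<close>-th diagonal entry is
  \<open>\<Sum>\<^sub>k c\<^sub>k |l\<^sub>k|\<close> (\<open>mat_abs_unitary_conjugate\<close>, \<open>diag_entry_of_unitary_conjugate\<close>).

  On the right, deleting the vertex deletes row and column \<open>i\<close> of \<open>z I - A\<close>, up to a simultaneous
  renumbering of rows and columns (\<open>poly_graph_char_poly_del_vert\<close>). By Cramer's rule the quotient of
  the two characteristic polynomials at \<open>z\<close> is the \<open>i\<close>-th diagonal entry of the resolvent
  \<open>(z I - A)\<^sup>-\<^sup>1\<close>, which is \<open>\<Sum>\<^sub>k c\<^sub>k / (z - l\<^sub>k)\<close> (\<open>resolvent_diagonal_entry\<close>). As the weights sum
  to 1, the integrand at \<open>z = \<i>x\<close> becomes \<open>\<Sum>\<^sub>k c\<^sub>k l\<^sub>k / (l\<^sub>k - \<i>x)\<close>. The real part of each kernel is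
  \<open>l\<^sub>k\<^sup>2 / (l\<^sub>k\<^sup>2 + x\<^sup>2)\<close>, with integral \<open>\<pi> |l\<^sub>k|\<close>; the imaginary part is odd and
  vanishes in the principal value (\<open>pv_integral_sum_cauchy_kernels\<close>).\<close>

unbundle no vec_syntax

section \<open>Adjoints and unitary matrices\<close>

lemma mat_adjoint_carrier [simp]:
  "A \<in> carrier_mat m n \<Longrightarrow> mat_adjoint A \<in> carrier_mat n m"
  unfolding mat_adjoint_def by auto

lemma mat_adjoint_dim [simp]:
  "dim_row (mat_adjoint A) = dim_col A" "dim_col (mat_adjoint A) = dim_row A"
  unfolding mat_adjoint_def by auto

lemma mat_adjoint_index [simp]:
  "i < dim_col A \<Longrightarrow> j < dim_row A \<Longrightarrow> mat_adjoint A $$ (i, j) = conjugate (A $$ (j, i))"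
  unfolding mat_adjoint_def by (simp add: mat_of_rows_def)

lemma mat_adjoint_adjoint [simp]: "mat_adjoint (mat_adjoint A) = A"
  by (rule eq_matI) auto

lemma mat_adjoint_mult:
  fixes A B :: "complex mat"
  assumes "A \<in> carrier_mat k m" "B \<in> carrier_mat m n"
  shows "mat_adjoint (A * B) = mat_adjoint B * mat_adjoint A"
  using assms by (intro eq_matI) (auto simp: scalar_prod_def mult.commute)

lemma mat_adjoint_mat_diag:
  "mat_adjoint (mat_diag n (f :: nat \<Rightarrow> complex)) = mat_diag n (\<lambda>i. cnj (f i))"
  by (rule eq_matI) (auto simp: mat_diag_def)

definition unitary_mat :: "nat \<Rightarrow> complex mat \<Rightarrow> bool" where
  "unitary_mat n U \<longleftrightarrow> U \<in> carrier_mat n n \<and> mat_adjoint U * U = 1\<^sub>m n"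

lemma unitary_matD:
  assumes "unitary_mat n U"
  shows "U \<in> carrier_mat n n" "mat_adjoint U * U = 1\<^sub>m n" "U * mat_adjoint U = 1\<^sub>m n"
  using assms mat_mult_left_right_inverse[of "mat_adjoint U" n U]
  unfolding unitary_mat_def by auto

lemma unitary_mat_mult:
  assumes "unitary_mat n U" "unitary_mat n V"
  shows "unitary_mat n (U * V)"
proof -
  note U = unitary_matD[OF assms(1)] and V = unitary_matD[OF assms(2)]
  have "mat_adjoint (U * V) * (U * V) = mat_adjoint V * (mat_adjoint U * (U * V))"
    using U(1) V(1) by (simp add: mat_adjoint_mult[of _ n n _ n] assoc_mult_mat[of _ n n _ n _ n] mult_carrier_mat[of _ n n _ n])
  also have "\<dots> = mat_adjoint V * ((mat_adjoint U * U) * V)"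
    using U(1) V(1) by (simp add: assoc_mult_mat[of _ n n _ n _ n] mult_carrier_mat[of _ n n _ n])
  also have "\<dots> = 1\<^sub>m n" using U V by simp
  finally show ?thesis using U(1) V(1) unfolding unitary_mat_def by auto
qed

text \<open>Deflating a Hermitian matrix needs an orthonormal basis that starts with a multiple of a given
  vector: complete the vector to a basis, orthogonalise it by Gram-Schmidt, which keeps the first
  vector, and normalise.\<close>

lemma unitary_mat_with_first_column:
  fixes v :: "complex vec"
  assumes v: "v \<in> carrier_vec n" and v0: "v \<noteq> 0\<^sub>v n" and n: "0 < n"
  obtains W c where "unitary_mat n W" "col W 0 = c \<cdot>\<^sub>v v"
proof -
  interpret cof_vec_space n "TYPE(complex)" .
  define b where "b = basis_completion v"
  define ws where "ws = gram_schmidt n b"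
  from basis_completion[OF v v0, folded b_def]
  have b: "distinct b" "\<not> lin_dep (set b)" "set b \<subseteq> carrier_vec n" "hd b = v" "length b = n"
    by auto
  then obtain vs where bv: "b = v # vs" using n by (cases b) auto
  from gram_schmidt_result[OF b(3,1,2) refl, folded ws_def]
  have ws: "set ws \<subseteq> carrier_vec n" "corthogonal ws" "length ws = n" by (auto simp: b(5))
  have hdws: "ws ! 0 = v" using gram_schmidt_hd[OF v, of vs, folded bv] ws(3) n
    unfolding ws_def by (cases "gram_schmidt n b") auto
  have wsc: "ws ! j \<in> carrier_vec n" if "j < n" for j using ws that by auto
  define c where "c j = complex_of_real (1 / sqrt (Re ((ws ! j) \<bullet>c (ws ! j))))" for j
  have cnj_c: "cnj (c j) = c j" for j by (simp add: c_def)
  define W where "W = mat n n (\<lambda>(i, j). c j * (ws ! j) $ i)"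
  have orth: "(ws ! i) \<bullet>c (ws ! j) = 0 \<longleftrightarrow> i \<noteq> j" if "i < n" "j < n" for i j
    using corthogonalD[OF ws(2)] ws(3) that by auto
  have norm: "c j * c j * ((ws ! j) \<bullet>c (ws ! j)) = 1" if j: "j < n" for j
  proof -
    let ?s = "(ws ! j) \<bullet>c (ws ! j)"
    have "?s \<ge> 0" by (rule conjugate_square_ge_0_vec)
    then have s: "?s = of_real (Re ?s)" "Re ?s \<ge> 0" by (auto simp: less_eq_complex_def complex_eq_iff)
    have "Re ?s > 0" using s orth[OF j j] by (metis less_eq_real_def of_real_0)
    then have "c j * c j = 1 / of_real (Re ?s)" unfolding c_def
      by (simp flip: of_real_mult)
    then show ?thesis using s(1) \<open>Re ?s > 0\<close> by (metis nonzero_divide_eq_eq of_real_eq_0_iff less_irrefl)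
  qed
  have "mat_adjoint W * W = 1\<^sub>m n"
  proof (rule eq_matI)
    fix i j assume ij: "i < dim_row (1\<^sub>m n :: complex mat)" "j < dim_col (1\<^sub>m n :: complex mat)"
    then have ij': "i < n" "j < n" by auto
    have "(mat_adjoint W * W) $$ (i, j) = (\<Sum>k<n. cnj (c i * (ws ! i) $ k) * (c j * (ws ! j) $ k))"
      using ij' by (auto simp: W_def scalar_prod_def lessThan_atLeast0)
    also have "\<dots> = c i * c j * (\<Sum>k<n. (ws ! j) $ k * cnj ((ws ! i) $ k))"
      by (simp add: sum_distrib_left cnj_c mult_ac)
    also have "(\<Sum>k<n. (ws ! j) $ k * cnj ((ws ! i) $ k)) = (ws ! j) \<bullet>c (ws ! i)"
      using wsc[OF ij'(1)] by (auto simp: scalar_prod_def lessThan_atLeast0)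
    also have "c i * c j * \<dots> = 1\<^sub>m n $$ (i, j)"
      using ij' orth[OF ij'(2,1)] norm[OF ij'(1)] by auto
    finally show "(mat_adjoint W * W) $$ (i, j) = 1\<^sub>m n $$ (i, j)" .
  qed (auto simp: W_def)
  moreover have "W \<in> carrier_mat n n" by (simp add: W_def)
  moreover have "col W 0 = c 0 \<cdot>\<^sub>v v"
    using n v by (intro eq_vecI) (auto simp: W_def hdws)
  ultimately show thesis using that unfolding unitary_mat_def by blast
qed

section \<open>The spectral theorem for Hermitian matrices\<close>

lemma mult_block_diagonal_mat:
  fixes a b P Q :: "'a :: semiring_1 mat"
  assumes "a \<in> carrier_mat 1 1" "b \<in> carrier_mat 1 1" "P \<in> carrier_mat n n" "Q \<in> carrier_mat n n"
  shows "four_block_mat a (0\<^sub>m 1 n) (0\<^sub>m n 1) P * four_block_mat b (0\<^sub>m 1 n) (0\<^sub>m n 1) Q =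
    four_block_mat (a * b) (0\<^sub>m 1 n) (0\<^sub>m n 1) (P * Q)"
  using assms mult_carrier_mat[OF assms(1,2)] mult_carrier_mat[OF assms(3,4)]
  by (subst mult_four_block_mat[of _ 1 1 _ n _ n _ _ 1 _ n]) (auto simp del: One_nat_def)

text \<open>The spectral theorem, by deflation. If the first column of the unitary matrix \<open>W\<close> is an
  eigenvector of \<open>A\<close>, then the first column of \<open>W\<^sup>* A W\<close> is a multiple of the first unit vector.
  Since \<open>W\<^sup>* A W\<close> is Hermitian, its first row vanishes off the diagonal too, the eigenvalue is
  real, and a smaller Hermitian block remains.\<close>

lemma hermitian_unitarily_diagonalizable:
  fixes A :: "complex mat"
  assumes "A \<in> carrier_mat n n" "mat_adjoint A = A"
  obtains U and l :: "nat \<Rightarrow> real"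
    where "unitary_mat n U" "A = U * mat_diag n (\<lambda>i. of_real (l i)) * mat_adjoint U"
proof -
  have "\<exists>U (l :: nat \<Rightarrow> real). unitary_mat n U \<and> mat_adjoint U * A * U = mat_diag n (\<lambda>i. of_real (l i))"
    using assms
  proof (induction n arbitrary: A)
    case 0
    then show ?case by (intro exI[of _ "1\<^sub>m 0"]) (auto simp: unitary_mat_def mat_diag_def intro!: eq_matI)
  next
    case (Suc n)
    let ?N = "Suc n"
    note A = Suc.prems(1) and hA = Suc.prems(2)
    from spectrum_non_empty[OF A] obtain e v where "eigenvector A v e"
      unfolding spectrum_def eigenvalue_def by auto
    then have v: "v \<in> carrier_vec ?N" "v \<noteq> 0\<^sub>v ?N" and Av: "A *\<^sub>v v = e \<cdot>\<^sub>v v"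
      using A unfolding eigenvector_def by auto
    obtain W c where W: "unitary_mat ?N W" and W0: "col W 0 = c \<cdot>\<^sub>v v"
      using unitary_mat_with_first_column[OF v] by blast
    note W' = unitary_matD[OF W]
    define B where "B = mat_adjoint W * A * W"
    have B: "B \<in> carrier_mat ?N ?N" using A W' by (auto simp: B_def)
    have hB: "mat_adjoint B = B"
      using A W'(1) hA by (simp add: B_def mat_adjoint_mult[of _ ?N ?N _ ?N]
        assoc_mult_mat[of _ ?N ?N _ ?N _ ?N] mult_carrier_mat[of _ ?N ?N _ ?N])
    have W0c: "col W 0 \<in> carrier_vec ?N" using W'(1) by (metis col_dim carrier_matD(1))
    have AW0: "A *\<^sub>v col W 0 = e \<cdot>\<^sub>v col W 0"
      unfolding W0 using A v Av by (simp add: mult_mat_vec[of _ ?N ?N] smult_smult_assoc mult.commute)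
    have colB: "B $$ (i, 0) = e * 1\<^sub>m ?N $$ (i, 0)" if i: "i < ?N" for i
    proof -
      have "col B 0 = mat_adjoint W *\<^sub>v (A *\<^sub>v col W 0)"
        using A W'(1) W0c unfolding B_def
        by (subst col_mult2[of _ ?N ?N _ ?N]) (auto simp: assoc_mult_mat_vec[of _ ?N ?N _ ?N] mult_carrier_mat[of _ ?N ?N _ ?N])
      also have "\<dots> = e \<cdot>\<^sub>v col (mat_adjoint W * W) 0"
        using W'(1) W0c unfolding AW0
        by (subst col_mult2[of _ ?N ?N _ ?N]) (auto simp: mult_mat_vec[of _ ?N ?N])
      finally have "col B 0 = e \<cdot>\<^sub>v col (1\<^sub>m ?N) 0" unfolding W'(2) .
      then have "col B 0 $ i = (e \<cdot>\<^sub>v col (1\<^sub>m ?N) 0) $ i" by simp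
      then show ?thesis using i B by simp
    qed
    have Bsym: "B $$ (i, j) = cnj (B $$ (j, i))" if "i < ?N" "j < ?N" for i j
      using arg_cong[OF hB, of "\<lambda>M. M $$ (i, j)"] that B by simp
    have e: "e = of_real (Re e)"
      using Bsym[of 0 0] colB[of 0] by (simp add: complex_eq_iff)
    define C where "C = mat n n (\<lambda>(i, j). B $$ (Suc i, Suc j))"
    have C: "C \<in> carrier_mat n n" by (simp add: C_def)
    have "mat_adjoint C = C" by (rule eq_matI) (auto simp: C_def Bsym[symmetric])
    from Suc.IH[OF C this] obtain V l where V: "unitary_mat n V"
      and VC: "mat_adjoint V * C * V = mat_diag n (\<lambda>i. complex_of_real (l i))" by blast
    note V' = unitary_matD[OF V]
    have Bblock: "B = four_block_mat (e \<cdot>\<^sub>m 1\<^sub>m 1) (0\<^sub>m 1 n) (0\<^sub>m n 1) C"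
    proof (rule eq_matI)
      fix i j
      assume "i < dim_row (four_block_mat (e \<cdot>\<^sub>m 1\<^sub>m 1) (0\<^sub>m 1 n) (0\<^sub>m n 1) C)"
        "j < dim_col (four_block_mat (e \<cdot>\<^sub>m 1\<^sub>m 1) (0\<^sub>m 1 n) (0\<^sub>m n 1) C)"
      then have ij: "i < ?N" "j < ?N" using C by auto
      show "B $$ (i, j) = four_block_mat (e \<cdot>\<^sub>m 1\<^sub>m 1) (0\<^sub>m 1 n) (0\<^sub>m n 1) C $$ (i, j)"
        using ij colB[OF ij(1)] colB[OF ij(2)] Bsym[OF ij] C
        by (cases i; cases j) (auto simp: C_def)
    qed (use B C in auto)
    define X where "X = four_block_mat (1\<^sub>m 1) (0\<^sub>m 1 n) (0\<^sub>m n 1) V"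
    have X: "X \<in> carrier_mat ?N ?N" using V'(1) by (auto simp: X_def)
    have aX: "mat_adjoint X = four_block_mat (1\<^sub>m 1) (0\<^sub>m 1 n) (0\<^sub>m n 1) (mat_adjoint V)"
      using V'(1) by (intro eq_matI) (auto simp: X_def)
    have uX: "unitary_mat ?N X"
      using X V' unfolding unitary_mat_def aX unfolding X_def
      by (auto simp: mult_block_diagonal_mat simp del: One_nat_def intro!: eq_matI)
    have "mat_adjoint X * B * X =
        four_block_mat (e \<cdot>\<^sub>m 1\<^sub>m 1) (0\<^sub>m 1 n) (0\<^sub>m n 1) (mat_adjoint V * C * V)"
      unfolding aX Bblock unfolding X_def
      using C V'(1) mult_carrier_mat[OF mat_adjoint_carrier[OF V'(1)] C]
      by (simp add: mult_block_diagonal_mat del: One_nat_def)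
    also have "\<dots> = mat_diag ?N (\<lambda>i. of_real (case i of 0 \<Rightarrow> Re e | Suc j \<Rightarrow> l j))"
      unfolding VC using e by (intro eq_matI) (auto simp: mat_diag_def split: nat.split)
    also have "mat_adjoint X * B * X = mat_adjoint (W * X) * A * (W * X)"
      using A W'(1) X unfolding B_def
      by (simp add: mat_adjoint_mult[of _ ?N ?N _ ?N] assoc_mult_mat[of _ ?N ?N _ ?N _ ?N] mult_carrier_mat[of _ ?N ?N _ ?N])
    finally show ?case using unitary_mat_mult[OF W uX] by blast
  qed
  then obtain U and l :: "nat \<Rightarrow> real" where U: "unitary_mat n U"
    and D: "mat_adjoint U * A * U = mat_diag n (\<lambda>i. of_real (l i))" by blast
  note U' = unitary_matD[OF U]
  have "U * (mat_adjoint U * A * U) * mat_adjoint U = (U * mat_adjoint U) * A * (U * mat_adjoint U)"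
    using U'(1) assms(1) by (simp add: assoc_mult_mat[of _ n n _ n _ n] mult_carrier_mat[of _ n n _ n])
  also have "\<dots> = A" using U' assms(1) by simp
  finally show thesis using that[OF U, of l] unfolding D by simp
qed

section \<open>Diagonalised matrices and their resolvents\<close>

lemma mat_diag_conjugate_carrier [simp]:
  "U \<in> carrier_mat n n \<Longrightarrow> U * mat_diag n f * mat_adjoint U \<in> carrier_mat n n"
  by (simp add: mult_carrier_mat[of _ n n _ n])

lemma unitary_row_norm:
  assumes "unitary_mat n U" "i < n"
  shows "(\<Sum>k<n. (cmod (U $$ (i, k)))\<^sup>2) = 1"
proof -
  note U = unitary_matD[OF assms(1)]
  have "(U * mat_adjoint U) $$ (i, i) = (\<Sum>k<n. U $$ (i, k) * cnj (U $$ (i, k)))"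
    using U(1) assms(2) by (auto simp: scalar_prod_def lessThan_atLeast0)
  also have "\<dots> = of_real (\<Sum>k<n. (cmod (U $$ (i, k)))\<^sup>2)"
    unfolding of_real_sum complex_norm_square ..
  finally show ?thesis using U(3) assms(2) by (metis index_one_mat(1) of_real_eq_1_iff)
qed

lemma diag_entry_of_unitary_conjugate:
  assumes U: "U \<in> carrier_mat n n" and i: "i < n"
  shows "(U * mat_diag n f * mat_adjoint U) $$ (i, i) =
    (\<Sum>k<n. of_real ((cmod (U $$ (i, k)))\<^sup>2) * f k)"
proof -
  have "(U * mat_diag n f * mat_adjoint U) $$ (i, i) = (\<Sum>k<n. U $$ (i, k) * f k * cnj (U $$ (i, k)))"
    using U i by (simp add: mat_diag_mult_right[of _ n n] scalar_prod_def lessThan_atLeast0)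
  also have "\<dots> = (\<Sum>k<n. of_real ((cmod (U $$ (i, k)))\<^sup>2) * f k)"
    by (intro sum.cong refl) (unfold complex_norm_square, simp add: mult_ac)
  finally show ?thesis .
qed

lemma unitary_conjugate_mult:
  assumes "unitary_mat n U"
  shows "(U * mat_diag n f * mat_adjoint U) * (U * mat_diag n g * mat_adjoint U) =
    U * mat_diag n (\<lambda>k. f k * g k) * mat_adjoint U"
proof -
  note U = unitary_matD[OF assms]
  have "(U * mat_diag n f * mat_adjoint U) * (U * mat_diag n g * mat_adjoint U) =
    U * mat_diag n f * ((mat_adjoint U * U) * (mat_diag n g * mat_adjoint U))"
    using U(1) by (simp add: assoc_mult_mat[of _ n n _ n _ n] mult_carrier_mat[of _ n n _ n])
  also have "\<dots> = U * (mat_diag n f * mat_diag n g) * mat_adjoint U"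
    using U(1) mult_carrier_mat[OF mat_diag_dim[of n g] mat_adjoint_carrier[OF U(1)]]
    by (simp add: U(2) left_mult_one_mat[of _ n n] assoc_mult_mat[of _ n n _ n _ n] mult_carrier_mat[of _ n n _ n] del: mat_diag_diag)
  finally show ?thesis by simp
qed

text \<open>Cramer's rule: the \<open>i\<close>-th diagonal entry of \<open>M\<^sup>-\<^sup>1\<close> is a principal minor of \<open>M\<close> divided by
  \<open>det M\<close>. For \<open>M = z I - A\<close> the inverse is diagonalised by the same \<open>U\<close> as \<open>A\<close>, with eigenvalues
  \<open>1 / (z - f k)\<close>.\<close>

lemma resolvent_diagonal_entry:
  assumes U: "unitary_mat n U" and i: "i < n"
    and A: "A = U * mat_diag n f * mat_adjoint U"
    and z: "\<And>k. k < n \<Longrightarrow> z \<noteq> f k"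
  shows "det (mat_delete (z \<cdot>\<^sub>m 1\<^sub>m n - A) i i) / det (z \<cdot>\<^sub>m 1\<^sub>m n - A) =
    (\<Sum>k<n. of_real ((cmod (U $$ (i, k)))\<^sup>2) / (z - f k))"
proof -
  note U' = unitary_matD[OF U]
  define M where "M = z \<cdot>\<^sub>m 1\<^sub>m n - A"
  define N where "N = U * mat_diag n (\<lambda>k. 1 / (z - f k)) * mat_adjoint U"
  have Ac: "A \<in> carrier_mat n n" using U'(1) by (simp add: A)
  then have M: "M \<in> carrier_mat n n" unfolding M_def by (rule minus_carrier_mat)
  have N: "N \<in> carrier_mat n n" using U'(1) by (simp add: N_def)
  have "mat_diag n (\<lambda>k. z - f k) = z \<cdot>\<^sub>m 1\<^sub>m n - mat_diag n f"
    by (rule eq_matI) (auto simp: mat_diag_def)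
  then have "U * mat_diag n (\<lambda>k. z - f k) * mat_adjoint U = z \<cdot>\<^sub>m (U * mat_adjoint U) - A"
    using U'(1) by (simp add: A mult_minus_distrib_mat[of _ n n _ n] minus_mult_distrib_mat[of _ n n _ _ n]
      mult_smult_distrib[of _ n n _ n] mult_smult_assoc_mat[of _ n n _ n])
  then have MU: "M = U * mat_diag n (\<lambda>k. z - f k) * mat_adjoint U" by (simp add: M_def U'(3))
  have "M * N = U * mat_diag n (\<lambda>k. (z - f k) * (1 / (z - f k))) * mat_adjoint U"
    unfolding MU N_def by (rule unitary_conjugate_mult[OF U])
  also have "mat_diag n (\<lambda>k. (z - f k) * (1 / (z - f k))) = 1\<^sub>m n"
    using z by (intro eq_matI) (auto simp: mat_diag_def)
  finally have MN: "M * N = 1\<^sub>m n" using U' by simp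
  have detM: "det M \<noteq> 0" using det_mult[OF M N] MN by auto
  have adj: "Determinant.adj_mat M \<in> carrier_mat n n" "Determinant.adj_mat M * M = det M \<cdot>\<^sub>m 1\<^sub>m n"
    using adj_mat[OF M] by auto
  have "Determinant.adj_mat M = Determinant.adj_mat M * (M * N)" using adj MN by simp
  also have "\<dots> = det M \<cdot>\<^sub>m N"
    using adj M N by (simp add: assoc_mult_mat[of _ n n _ n _ n, symmetric] mult_carrier_mat[of _ n n _ n] mult_smult_assoc_mat[of _ n n _ n])
  finally have "Determinant.adj_mat M $$ (i, i) = det M * N $$ (i, i)" using i N by simp
  moreover have "Determinant.adj_mat M $$ (i, i) = det (mat_delete M i i)"
    using M i by (simp add: Determinant.adj_mat_def cofactor_def)
  ultimately have "det (mat_delete M i i) / det M = N $$ (i, i)" using detM by simp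
  also have "\<dots> = (\<Sum>k<n. of_real ((cmod (U $$ (i, k)))\<^sup>2) / (z - f k))"
    unfolding N_def using diag_entry_of_unitary_conjugate[OF U'(1) i] by simp
  finally show ?thesis by (simp add: M_def)
qed

section \<open>Positive semidefinite square roots and the absolute value\<close>

text \<open>In the coordinates \<open>U\<^sup>* v\<close> the quadratic form is a weighted sum of squared moduli. Hence it is
  nonnegative when the diagonal entries are; conversely, for unitary \<open>U\<close>, evaluating it on the
  columns of \<open>U\<close> recovers each diagonal entry.\<close>

lemma quadratic_form_unitary_conjugate:
  assumes U: "U \<in> carrier_mat n n" and v: "v \<in> carrier_vec n"
  shows "(U * mat_diag n f * mat_adjoint U *\<^sub>v v) \<bullet>c v =
    (\<Sum>k<n. f k * of_real ((cmod ((mat_adjoint U *\<^sub>v v) $ k))\<^sup>2))"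
proof -
  define w where "w = mat_adjoint U *\<^sub>v v"
  have w: "w \<in> carrier_vec n" using U v mult_mat_vec_carrier[OF mat_adjoint_carrier[OF U] v] by (simp add: w_def)
  have wk: "w $ k = (\<Sum>j<n. cnj (U $$ (j, k)) * v $ j)" if "k < n" for k
    using U v that by (auto simp: w_def scalar_prod_def lessThan_atLeast0)
  have "U * mat_diag n f * mat_adjoint U *\<^sub>v v = (U * mat_diag n f) *\<^sub>v w"
    using U v by (simp add: w_def assoc_mult_mat_vec[of _ n n _ n] mult_carrier_mat[of _ n n _ n])
  then have "(U * mat_diag n f * mat_adjoint U *\<^sub>v v) \<bullet>c v =
    (\<Sum>j<n. (\<Sum>k<n. U $$ (j, k) * f k * w $ k) * cnj (v $ j))"
    using U v w by (simp add: mat_diag_mult_right[of _ n n] scalar_prod_def lessThan_atLeast0)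
  also have "\<dots> = (\<Sum>k<n. f k * w $ k * (\<Sum>j<n. U $$ (j, k) * cnj (v $ j)))"
    unfolding sum_distrib_right sum_distrib_left by (subst sum.swap) (simp add: mult_ac)
  also have "\<dots> = (\<Sum>k<n. f k * (w $ k * cnj (w $ k)))"
    by (intro sum.cong refl) (simp add: wk mult.assoc)
  finally show ?thesis unfolding complex_norm_square w_def .
qed

lemma psd_mat_unitary_conjugate:
  assumes U: "U \<in> carrier_mat n n" and l: "\<And>k. k < n \<Longrightarrow> 0 \<le> l k"
  shows "psd_mat n (U * mat_diag n (\<lambda>k. of_real (l k)) * mat_adjoint U)"
  unfolding psd_mat_def
proof (intro conjI ballI)
  show "U * mat_diag n (\<lambda>k. of_real (l k)) * mat_adjoint U \<in> carrier_mat n n"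
    using U by (rule mat_diag_conjugate_carrier)
  show "mat_adjoint (U * mat_diag n (\<lambda>k. of_real (l k)) * mat_adjoint U) =
      U * mat_diag n (\<lambda>k. of_real (l k)) * mat_adjoint U"
    using U by (simp add: mat_adjoint_mult[of _ n n _ n] mat_adjoint_mat_diag assoc_mult_mat[of _ n n _ n _ n] mult_carrier_mat[of _ n n _ n])
  fix v :: "complex vec" assume v: "v \<in> carrier_vec n"
  show "0 \<le> (U * mat_diag n (\<lambda>k. of_real (l k)) * mat_adjoint U *\<^sub>v v) \<bullet>c v"
    unfolding quadratic_form_unitary_conjugate[OF U v]
    using l by (intro sum_nonneg mult_nonneg_nonneg) (auto simp: less_eq_complex_def)
qed

lemma psd_mat_diagonalizable:
  assumes B: "psd_mat n B"
  obtains U and l :: "nat \<Rightarrow> real" where "unitary_mat n U" "\<And>k. k < n \<Longrightarrow> 0 \<le> l k"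
    "B = U * mat_diag n (\<lambda>k. of_real (l k)) * mat_adjoint U"
proof -
  have Bc: "B \<in> carrier_mat n n" "mat_adjoint B = B"
    and pos: "\<And>v. v \<in> carrier_vec n \<Longrightarrow> 0 \<le> (B *\<^sub>v v) \<bullet>c v"
    using B by (auto simp: psd_mat_def)
  obtain U and l :: "nat \<Rightarrow> real" where U: "unitary_mat n U"
    and BU: "B = U * mat_diag n (\<lambda>k. of_real (l k)) * mat_adjoint U"
    using hermitian_unitarily_diagonalizable[OF Bc] by blast
  note U' = unitary_matD[OF U]
  have "0 \<le> l k" if k: "k < n" for k
  proof -
    have c: "col U k \<in> carrier_vec n" using U'(1) by (metis col_dim carrier_matD(1))
    have e: "mat_adjoint U *\<^sub>v col U k = col (1\<^sub>m n) k"
      using U'(1) k unfolding U'(2)[symmetric] by (subst col_mult2[of _ n n _ n]) auto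
    have "(B *\<^sub>v col U k) \<bullet>c col U k = (\<Sum>j<n. of_real (l j) * of_real ((cmod (col (1\<^sub>m n) k $ j))\<^sup>2))"
      unfolding BU quadratic_form_unitary_conjugate[OF U'(1) c] e ..
    also have "\<dots> = (\<Sum>j<n. if j = k then of_real (l j) else 0)"
      using k by (intro sum.cong) auto
    also have "\<dots> = of_real (l k)" using k by simp
    finally show ?thesis using pos[OF c] by (simp add: less_eq_complex_def)
  qed
  then show thesis using that U BU by blast
qed

text \<open>Diagonalise \<open>B\<close> by \<open>U\<close> and \<open>C\<close> by \<open>V\<close>, and let \<open>W = U\<^sup>* V\<close>. From \<open>B\<^sup>2 = C\<^sup>2\<close> one gets
  \<open>b\<^sub>i\<^sup>2 W\<^sub>i\<^sub>j = W\<^sub>i\<^sub>j c\<^sub>j\<^sup>2\<close>, so \<open>b\<^sub>i = c\<^sub>j\<close> wherever \<open>W\<^sub>i\<^sub>j \<noteq> 0\<close>, the eigenvalues being nonnegative.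
  Thus \<open>W\<close> intertwines the two diagonal matrices themselves, which says that \<open>B = C\<close>.\<close>

lemma psd_square_root_unique:
  assumes B: "psd_mat n B" and C: "psd_mat n C" and eq: "B * B = C * C"
  shows "B = C"
proof -
  obtain U and b :: "nat \<Rightarrow> real" where U: "unitary_mat n U" and b: "\<And>k. k < n \<Longrightarrow> 0 \<le> b k"
    and BU: "B = U * mat_diag n (\<lambda>k. of_real (b k)) * mat_adjoint U"
    using psd_mat_diagonalizable[OF B] by blast
  obtain V and c :: "nat \<Rightarrow> real" where V: "unitary_mat n V" and c: "\<And>k. k < n \<Longrightarrow> 0 \<le> c k"
    and CV: "C = V * mat_diag n (\<lambda>k. of_real (c k)) * mat_adjoint V"
    using psd_mat_diagonalizable[OF C] by blast
  note U' = unitary_matD[OF U] and V' = unitary_matD[OF V]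
  define W where "W = mat_adjoint U * V"
  have W: "W \<in> carrier_mat n n" using mult_carrier_mat[OF mat_adjoint_carrier[OF U'(1)] V'(1)] by (simp add: W_def)
  have intertwine: "mat_adjoint U * (U * mat_diag n f * mat_adjoint U) * V = mat_diag n f * W"
    "mat_adjoint U * (V * mat_diag n f * mat_adjoint V) * V = W * mat_diag n f" for f
  proof -
    have "mat_adjoint U * (U * mat_diag n f * mat_adjoint U) * V = (mat_adjoint U * U) * (mat_diag n f * W)"
      using U'(1) V'(1) by (simp add: W_def assoc_mult_mat[of _ n n _ n _ n] mult_carrier_mat[of _ n n _ n])
    then show "mat_adjoint U * (U * mat_diag n f * mat_adjoint U) * V = mat_diag n f * W"
      using U'(2) W by (simp add: left_mult_one_mat[of _ n n] mult_carrier_mat[of _ n n _ n])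
    have "mat_adjoint U * (V * mat_diag n f * mat_adjoint V) * V = (W * mat_diag n f) * (mat_adjoint V * V)"
      using U'(1) V'(1) by (simp add: W_def assoc_mult_mat[of _ n n _ n _ n] mult_carrier_mat[of _ n n _ n])
    then show "mat_adjoint U * (V * mat_diag n f * mat_adjoint V) * V = W * mat_diag n f"
      using V'(2) W by (simp add: right_mult_one_mat[of _ n n] mult_carrier_mat[of _ n n _ n])
  qed
  have "mat_diag n (\<lambda>k. of_real (b k) * of_real (b k)) * W = W * mat_diag n (\<lambda>k. of_real (c k) * of_real (c k))"
    using eq unfolding BU CV unitary_conjugate_mult[OF U] unitary_conjugate_mult[OF V]
    by (metis intertwine)
  then have sq: "of_real (b i) * of_real (b i) * W $$ (i, j) = W $$ (i, j) * (of_real (c j) * of_real (c j))"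
    if "i < n" "j < n" for i j
    using that W by (simp add: mat_diag_mult_left[of _ n n] mat_diag_mult_right[of _ n n] mat_eq_iff)
  have "of_real (b i) * W $$ (i, j) = W $$ (i, j) * of_real (c j)" if ij: "i < n" "j < n" for i j
  proof (cases "W $$ (i, j) = 0")
    case False
    then have "complex_of_real (b i * b i) = of_real (c j * c j)" using sq[OF ij] by simp
    then have "(b i)\<^sup>2 = (c j)\<^sup>2" by (simp only: of_real_eq_iff power2_eq_square)
    then have "b i = c j" using b[OF ij(1)] c[OF ij(2)] by simp
    then show ?thesis by simp
  qed simp
  then have "mat_diag n (\<lambda>k. of_real (b k)) * W = W * mat_diag n (\<lambda>k. of_real (c k))"
    using W by (simp add: mat_diag_mult_left[of _ n n] mat_diag_mult_right[of _ n n] mat_eq_iff)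
  then have "mat_adjoint U * B * V = mat_adjoint U * C * V" unfolding BU CV intertwine .
  then have "U * (mat_adjoint U * B * V) * mat_adjoint V = U * (mat_adjoint U * C * V) * mat_adjoint V"
    by simp
  moreover have "U * (mat_adjoint U * X * V) * mat_adjoint V = X" if X: "X \<in> carrier_mat n n" for X
  proof -
    have "U * (mat_adjoint U * X * V) * mat_adjoint V = (U * mat_adjoint U) * X * (V * mat_adjoint V)"
      using U'(1) V'(1) X by (simp add: assoc_mult_mat[of _ n n _ n _ n] mult_carrier_mat[of _ n n _ n])
    then show ?thesis using U'(3) V'(3) X by simp
  qed
  ultimately show ?thesis using B C by (simp add: psd_mat_def)
qed

lemma mat_abs_unitary_conjugate:
  fixes l :: "nat \<Rightarrow> real"
  assumes U: "unitary_mat n U" and A: "A = U * mat_diag n (\<lambda>k. of_real (l k)) * mat_adjoint U"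
  shows "mat_abs A = U * mat_diag n (\<lambda>k. of_real \<bar>l k\<bar>) * mat_adjoint U" (is "_ = ?B")
proof -
  note U' = unitary_matD[OF U]
  have hA: "mat_adjoint A = A"
    using U' by (simp add: A mat_adjoint_mult[of _ n n _ n] mat_adjoint_mat_diag assoc_mult_mat[of _ n n _ n _ n] mult_carrier_mat[of _ n n _ n])
  have psd: "psd_mat n ?B" by (rule psd_mat_unitary_conjugate[OF U'(1)]) simp
  have sq: "?B * ?B = A * mat_adjoint A"
    unfolding hA unfolding A unitary_conjugate_mult[OF U] of_real_mult[symmetric] abs_mult_self_eq ..
  have dim: "dim_row (A * mat_adjoint A) = n" using U'(1) by (simp add: A)
  show ?thesis unfolding mat_abs_def psd_sqrt_def dim
  proof (rule the_equality)
    show "psd_mat n ?B \<and> ?B * ?B = A * mat_adjoint A" using psd sq by blast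
    fix C assume "psd_mat n C \<and> C * C = A * mat_adjoint A"
    then show "C = ?B" by (intro psd_square_root_unique[OF _ psd]) (simp_all only: sq)
  qed
qed

section \<open>Characteristic polynomials of vertex-deleted graphs\<close>

text \<open>The sign of the permutation enters once for the rows and once for the columns, and squares to 1.\<close>

lemma det_permute_rows_and_columns:
  fixes A :: "'a :: comm_ring_1 mat"
  assumes A: "A \<in> carrier_mat n n" and p: "p permutes {0..<n}"
  shows "det (mat n n (\<lambda>(i, j). A $$ (p i, p j))) = det A"
proof -
  have pn: "p i < n" if "i < n" for i using permutes_in_image[OF p, of i] that by simp
  define B where "B = mat n n (\<lambda>(i, j). A $$ (p i, j))"
  have B: "B \<in> carrier_mat n n" by (simp add: B_def)
  have dB: "det B = signof p * det A" unfolding B_def by (rule det_permute_rows[OF A p])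
  have "mat n n (\<lambda>(i, j). A $$ (p i, p j)) = (mat n n (\<lambda>(i, j). B\<^sup>T $$ (p i, j)))\<^sup>T"
    using pn by (intro eq_matI) (auto simp: B_def)
  also have "det \<dots> = det (mat n n (\<lambda>(i, j). B\<^sup>T $$ (p i, j)))"
    by (rule det_transpose[of _ n]) simp
  also have "\<dots> = signof p * det (B\<^sup>T)"
    by (rule det_permute_rows[OF _ p]) (use B in simp)
  also have "\<dots> = (signof p * signof p) * det A"
    by (simp add: det_transpose[OF B] dB mult.assoc)
  also have "signof p * signof p = (1 :: 'a)"
    by (cases p rule: sign_cases) simp_all
  finally show ?thesis by simp
qed

lemma poly_char_poly_eq_det:
  fixes A :: "'a :: field mat"
  assumes "A \<in> carrier_mat n n"
  shows "poly (char_poly A) z = det (z \<cdot>\<^sub>m 1\<^sub>m n - A)"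
proof -
  have "- char_matrix A z = z \<cdot>\<^sub>m 1\<^sub>m n - A"
    using assms by (intro eq_matI) (auto simp: char_matrix_def)
  then show ?thesis by (simp add: char_poly_matrix[OF assms])
qed

lemma adj_mat_carrier [simp]: "Defs.adj_mat G vs \<in> carrier_mat (length vs) (length vs)"
  by (simp add: Defs.adj_mat_def)

lemma adjacency_del_vert:
  assumes "u \<noteq> w" "v \<noteq> w"
  shows "u \<rightarrow>\<^bsub>pre_digraph.del_vert G w\<^esub> v \<longleftrightarrow> u \<rightarrow>\<^bsub>G\<^esub> v"
  using assms by (auto simp: arcs_ends_def arc_to_ends_def pre_digraph.del_vert_def)

lemma adj_mat_hermitian:
  assumes "Digraph.graph G"
  shows "mat_adjoint (Defs.adj_mat G vs) = Defs.adj_mat G vs"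
proof -
  interpret Digraph.graph G by fact
  have "u \<rightarrow>\<^bsub>G\<^esub> v \<longleftrightarrow> v \<rightarrow>\<^bsub>G\<^esub> u" for u v
    using arcs_ends_symmetric[OF sym_arcs] by blast
  then show ?thesis
    by (intro eq_matI) (auto simp: Defs.adj_mat_def mat_adjoint_def mat_of_rows_def)
qed

text \<open>The labelling \<open>ws\<close> of the remaining vertices is arbitrary, so it agrees only up to a
  permutation with the list obtained by dropping the \<open>i\<close>-th entry of \<open>vs\<close>, and the latter is the
  one that indexes the minor.\<close>

lemma poly_graph_char_poly_del_vert:
  assumes vs: "vertex_enum G vs" and i: "i < length vs"
    and ws: "vertex_enum (pre_digraph.del_vert G (vs ! i)) ws"
  shows "poly (graph_char_poly (pre_digraph.del_vert G (vs ! i)) ws) z =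
    det (mat_delete (z \<cdot>\<^sub>m 1\<^sub>m (length vs) - Defs.adj_mat G vs) i i)"
proof -
  let ?H = "pre_digraph.del_vert G (vs ! i)"
  define us where "us = take i vs @ drop (Suc i) vs"
  have len: "length us = length vs - 1" using i by (simp add: us_def)
  have vs_split: "vs = take i vs @ vs ! i # drop (Suc i) vs" using i by (rule id_take_nth_drop)
  have dvs: "distinct vs" "set vs = verts G" using vs by (auto simp: vertex_enum_def)
  have "distinct (take i vs @ vs ! i # drop (Suc i) vs)" using dvs(1) vs_split by simp
  then have dus: "distinct us" "vs ! i \<notin> set us" by (auto simp: us_def)
  have "set vs = insert (vs ! i) (set us)" by (subst vs_split) (auto simp: us_def)
  then have "set us = set ws" using ws dus(2) dvs(2)
    by (auto simp: vertex_enum_def pre_digraph.del_vert_def)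
  then have "mset ws = mset us" using ws dus(1)
    by (metis vertex_enum_def set_eq_iff_mset_eq_distinct)
  then obtain p where p: "p permutes {..<length us}" "permute_list p us = ws"
    by (rule mset_eq_permutation)
  let ?m = "length us"
  have p0: "p permutes {0..<?m}" using p(1) by (simp add: lessThan_atLeast0)
  have pm: "p k < ?m" if "k < ?m" for k using permutes_in_image[OF p(1), of k] that by simp
  have lenw: "length ws = ?m" using p(2) by auto
  have wsn: "ws ! k = us ! p k" if "k < ?m" for k
    using permute_list_nth[OF p(1) that] p(2) by simp
  have usn: "us ! k = vs ! (if k < i then k else Suc k)" if "k < ?m" for k
    using that i len by (auto simp: us_def nth_append min_def)
  define M where "M = mat_delete (z \<cdot>\<^sub>m 1\<^sub>m (length vs) - Defs.adj_mat G vs) i i"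
  have M: "M \<in> carrier_mat ?m ?m" unfolding M_def len
    by (intro mat_delete_carrier minus_carrier_mat) simp
  have Mn: "M $$ (k, l) = (if k = l then z else 0) - (if us ! k \<rightarrow>\<^bsub>?H\<^esub> us ! l then 1 else 0)"
    if "k < ?m" "l < ?m" for k l
  proof -
    have "us ! k \<noteq> vs ! i" "us ! l \<noteq> vs ! i" using that dus(2) nth_mem by metis+
    then have "us ! k \<rightarrow>\<^bsub>?H\<^esub> us ! l \<longleftrightarrow> us ! k \<rightarrow>\<^bsub>G\<^esub> us ! l" by (rule adjacency_del_vert)
    then show ?thesis using that len i
      by (auto simp: M_def mat_delete_def usn Defs.adj_mat_def)
  qed
  have inj: "p k = p l \<longleftrightarrow> k = l" for k l using permutes_inj[OF p(1)] by (auto dest: injD)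
  have "z \<cdot>\<^sub>m 1\<^sub>m ?m - Defs.adj_mat ?H ws = mat ?m ?m (\<lambda>(k, l). M $$ (p k, p l))"
    by (intro eq_matI) (auto simp: Defs.adj_mat_def lenw Mn pm wsn inj)
  then have "poly (graph_char_poly ?H ws) z = det (mat ?m ?m (\<lambda>(k, l). M $$ (p k, p l)))"
    unfolding graph_char_poly_def
    by (subst poly_char_poly_eq_det[of _ ?m]) (auto simp: Defs.adj_mat_def lenw)
  also have "\<dots> = det M" by (rule det_permute_rows_and_columns[OF M p0])
  finally show ?thesis by (simp add: M_def)
qed

section \<open>Principal values of Cauchy kernels\<close>

text \<open>Splitting into real and imaginary part gives
  \<open>l / (l - \<i>x) = l\<^sup>2 / (l\<^sup>2 + x\<^sup>2) + \<i> l x / (l\<^sup>2 + x\<^sup>2)\<close>, with antiderivative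
  \<open>l arctan (x / l) + \<i> (l / 2) ln (l\<^sup>2 + x\<^sup>2)\<close>. The logarithm is even, so it cancels between \<open>-R\<close>
  and \<open>R\<close>. The case \<open>l = 0\<close> stands apart: the kernel is then 0, but its denominator
  vanishes at \<open>x = 0\<close>.\<close>

lemma cauchy_kernel_integral:
  fixes l R :: real
  assumes R: "R > 0"
  shows "set_integrable lborel {-R..R} (\<lambda>x. of_real l / (of_real l - \<i> * of_real x))"
    and "(LINT x:{-R..R}|lborel. of_real l / (of_real l - \<i> * of_real x)) =
      complex_of_real (2 * l * arctan (R / l))"
proof -
  let ?g = "\<lambda>x. of_real l / (of_real l - \<i> * complex_of_real x)"
  have "set_integrable lborel {-R..R} ?g \<and>
    (LINT x:{-R..R}|lborel. ?g x) = complex_of_real (2 * l * arctan (R / l))"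
  proof (cases "l = 0")
    case True
    then show ?thesis by (simp add: set_integrable_def set_lebesgue_integral_def)
  next
    case False
    have nz: "of_real l - \<i> * complex_of_real x \<noteq> 0" for x
      using False by (auto simp: complex_eq_iff)
    have nz2: "l\<^sup>2 + x\<^sup>2 \<noteq> 0" "l\<^sup>2 + x\<^sup>2 > 0" for x using False by (auto simp: sum_power2_gt_zero_iff)
    let ?G = "\<lambda>x. complex_of_real (l * arctan (x / l)) + \<i> * of_real (l / 2 * ln (l\<^sup>2 + x\<^sup>2))"
    have cont: "continuous_on {-R..R} ?g" by (intro continuous_intros) (use nz in auto)
    have deriv: "(?G has_vector_derivative ?g x) (at x within {-R..R})" for x
    proof -
      have "((\<lambda>x. l * arctan (x / l)) has_real_derivative l\<^sup>2 / (l\<^sup>2 + x\<^sup>2)) (at x within {-R..R})"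
        using False nz2[of x]
        by (auto intro!: derivative_eq_intros simp: divide_simps power2_eq_square)
      moreover have "((\<lambda>x. l / 2 * ln (l\<^sup>2 + x\<^sup>2)) has_real_derivative l * x / (l\<^sup>2 + x\<^sup>2))
          (at x within {-R..R})"
        using False nz2[of x]
        by (auto intro!: derivative_eq_intros simp: divide_simps)
      ultimately have "(?G has_vector_derivative
          (of_real (l\<^sup>2 / (l\<^sup>2 + x\<^sup>2)) + \<i> * of_real (l * x / (l\<^sup>2 + x\<^sup>2)))) (at x within {-R..R})"
        by (intro has_vector_derivative_add has_vector_derivative_mult_right
            has_vector_derivative_of_real)
      moreover have "of_real (l\<^sup>2 / (l\<^sup>2 + x\<^sup>2)) + \<i> * of_real (l * x / (l\<^sup>2 + x\<^sup>2)) = ?g x"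
        using nz2[of x] by (simp add: complex_eq_iff Re_divide Im_divide power2_eq_square)
      ultimately show ?thesis by metis
    qed
    have "set_integrable lborel {-R..R} ?g" 
      by (rule borel_integrable_atLeastAtMost'[OF cont])
    moreover have "(LINT x:{-R..R}|lborel. ?g x) = ?G R - ?G (-R)"
      unfolding set_lebesgue_integral_def
      by (rule integral_FTC_atLeastAtMost[OF _ _ cont]) (use R deriv in auto)
    ultimately show ?thesis by (simp add: arctan_minus)
  qed
  then show "set_integrable lborel {-R..R} ?g"
    "(LINT x:{-R..R}|lborel. ?g x) = complex_of_real (2 * l * arctan (R / l))" by auto
qed

lemma set_integral_sum:
  fixes f :: "'k \<Rightarrow> 'a \<Rightarrow> 'b :: {banach, second_countable_topology}"
  assumes "\<And>k. k \<in> K \<Longrightarrow> set_integrable M S (f k)"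
  shows "set_integrable M S (\<lambda>x. \<Sum>k\<in>K. f k x)"
    and "(LINT x:S|M. \<Sum>k\<in>K. f k x) = (\<Sum>k\<in>K. LINT x:S|M. f k x)"
  using assms unfolding set_integrable_def set_lebesgue_integral_def scaleR_sum_right
  by (simp_all add: Bochner_Integration.integral_sum)

lemma tendsto_arctan_abs:
  fixes l :: real
  shows "((\<lambda>R. 2 * l * arctan (R / l)) \<longlongrightarrow> pi * \<bar>l\<bar>) at_top"
proof (cases "l = 0")
  case False
  have eq: "2 * l * arctan (R / l) = 2 * \<bar>l\<bar> * arctan (R / \<bar>l\<bar>)" for R
    by (cases "l < 0") (auto simp: abs_if arctan_minus)
  have "filterlim (\<lambda>R. R / \<bar>l\<bar>) at_top at_top"
    using False filterlim_tendsto_pos_mult_at_top[OF tendsto_const _ filterlim_ident, of "1 / \<bar>l\<bar>"]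
    by simp
  then have "((\<lambda>R. 2 * \<bar>l\<bar> * arctan (R / \<bar>l\<bar>)) \<longlongrightarrow> 2 * \<bar>l\<bar> * (pi / 2)) at_top"
    by (intro tendsto_intros filterlim_compose[OF tendsto_arctan_at_top])
  then show ?thesis unfolding eq by (simp add: mult.commute)
qed simp

text \<open>The value \<open>f 0\<close> is left open, so that \<open>f\<close> may be given by an expression with a removable
  singularity at 0, where division by 0 yields a value other than the limit. A single point does
  not affect the integrals.\<close>

lemma pv_integral_sum_cauchy_kernels:
  fixes f :: "real \<Rightarrow> complex" and c l :: "'k \<Rightarrow> real"
  assumes f: "\<And>x. x \<noteq> 0 \<Longrightarrow> f x = (\<Sum>k\<in>K. of_real (c k) * (of_real (l k) / (of_real (l k) - \<i> * of_real x)))"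
  shows "pv_integrable f" "pv_integral f = of_real (pi * (\<Sum>k\<in>K. c k * \<bar>l k\<bar>))"
proof -
  define g where "g x = (\<Sum>k\<in>K. of_real (c k) * (of_real (l k) / (of_real (l k) - \<i> * complex_of_real x)))" for x
  have g [measurable]: "g \<in> borel_measurable lborel" unfolding g_def by measurable
  have fg: "f = (\<lambda>x. if x = 0 then f 0 else g x)" using f by (auto simp: g_def)
  have f_meas [measurable]: "f \<in> borel_measurable lborel" by (subst fg) measurable
  have ae: "AE x in lborel. f x = g x"
    using AE_lborel_singleton[of "0 :: real"] by eventually_elim (simp add: f g_def)
  have gi: "set_integrable lborel {-R..R} g" if "R > 0" for R
    unfolding g_def by (intro set_integral_sum set_integrable_mult_right cauchy_kernel_integral that)
  have fi: "set_integrable lborel {-R..R} f" if "R > 0" for R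
  proof -
    have "set_integrable lborel {-R..R} f \<longleftrightarrow> set_integrable lborel {-R..R} g"
      by (rule set_integrable_cong_AE) (use ae in auto)
    then show ?thesis using gi[OF that] by simp
  qed
  have int: "(LINT x:{-R..R}|lborel. f x) = of_real (\<Sum>k\<in>K. c k * (2 * l k * arctan (R / l k)))" if "R > 0" for R
  proof -
    have "(LINT x:{-R..R}|lborel. f x) = (LINT x:{-R..R}|lborel. g x)"
      by (rule set_lebesgue_integral_cong_AE) (use ae in auto)
    also have "\<dots> = (\<Sum>k\<in>K. LINT x:{-R..R}|lborel. of_real (c k) * (of_real (l k) / (of_real (l k) - \<i> * complex_of_real x)))"
      unfolding g_def by (intro set_integral_sum set_integrable_mult_right cauchy_kernel_integral that)
    also have "\<dots> = of_real (\<Sum>k\<in>K. c k * (2 * l k * arctan (R / l k)))"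
      unfolding of_real_sum of_real_mult[of "c _"] cauchy_kernel_integral(2)[OF that, symmetric]
      by (intro sum.cong refl set_integral_mult_right)
    finally show ?thesis .
  qed
  have "((\<lambda>R. complex_of_real (\<Sum>k\<in>K. c k * (2 * l k * arctan (R / l k)))) \<longlongrightarrow>
      of_real (\<Sum>k\<in>K. c k * (pi * \<bar>l k\<bar>))) at_top"
    by (intro tendsto_of_real tendsto_sum tendsto_mult_left tendsto_arctan_abs)
  then have lim: "((\<lambda>R. LINT x:{-R..R}|lborel. f x) \<longlongrightarrow> of_real (pi * (\<Sum>k\<in>K. c k * \<bar>l k\<bar>))) at_top"
    using int by (subst tendsto_cong[OF eventually_mono[OF eventually_gt_at_top[of 0]]])
      (auto simp: sum_distrib_left mult_ac)
  show "pv_integrable f" using fi lim unfolding pv_integrable_def by blast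
  show "pv_integral f = of_real (pi * (\<Sum>k\<in>K. c k * \<bar>l k\<bar>))"
    unfolding pv_integral_def by (rule tendsto_Lim[OF _ lim]) simp
qed

section \<open>Vertex energy as an integral\<close>

theorem theorem3p2:
  fixes G :: "('a, 'b) pre_digraph" and vs ws :: "'a list" and i :: nat
  assumes "Digraph.graph G"
    and "vertex_enum G vs"
    and "i < length vs"
    and "vertex_enum (pre_digraph.del_vert G (vs ! i)) ws"
  shows "pv_integrable (\<lambda>x. 1 - \<i> * of_real x
             * poly (graph_char_poly (pre_digraph.del_vert G (vs ! i)) ws) (\<i> * of_real x)
             / poly (graph_char_poly G vs) (\<i> * of_real x)) \<and>
         vertex_energy G vs i = 1 / of_real pi * pv_integral (\<lambda>x. 1 - \<i> * of_real x
             * poly (graph_char_poly (pre_digraph.del_vert G (vs ! i)) ws) (\<i> * of_real x)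
             / poly (graph_char_poly G vs) (\<i> * of_real x))"
proof -
  define n where "n = length vs"
  define A where "A = Defs.adj_mat G vs"
  have A: "A \<in> carrier_mat n n" by (simp add: A_def n_def)
  have i: "i < n" using assms(3) by (simp add: n_def)
  have "mat_adjoint A = A" unfolding A_def by (rule adj_mat_hermitian[OF assms(1)])
  then obtain U and l :: "nat \<Rightarrow> real" where U: "unitary_mat n U"
    and AU: "A = U * mat_diag n (\<lambda>k. of_real (l k)) * mat_adjoint U"
    using hermitian_unitarily_diagonalizable[OF A] by blast
  define c where "c k = (cmod (U $$ (i, k)))\<^sup>2" for k
  let ?f = "\<lambda>x. 1 - \<i> * of_real x
             * poly (graph_char_poly (pre_digraph.del_vert G (vs ! i)) ws) (\<i> * of_real x)
             / poly (graph_char_poly G vs) (\<i> * of_real x)"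
  have f: "?f x = (\<Sum>k<n. of_real (c k) * (of_real (l k) / (of_real (l k) - \<i> * of_real x)))"
    if x: "x \<noteq> 0" for x
  proof -
    let ?z = "\<i> * complex_of_real x"
    \<comment> \<open>A nonzero point of the imaginary axis is no eigenvalue, the eigenvalues being real.\<close>
    have z: "?z - of_real (l k) \<noteq> 0" for k using x by (auto simp: complex_eq_iff)
    have "poly (graph_char_poly (pre_digraph.del_vert G (vs ! i)) ws) ?z / poly (graph_char_poly G vs) ?z
      = (\<Sum>k<n. of_real (c k) / (?z - of_real (l k)))"
      unfolding poly_graph_char_poly_del_vert[OF assms(2-4)]
      unfolding graph_char_poly_def
        A_def[symmetric] n_def[symmetric] poly_char_poly_eq_det[OF A] c_def
      by (rule resolvent_diagonal_entry[OF U i AU]) (use z in auto)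
    then have "?f x = 1 - ?z * (\<Sum>k<n. of_real (c k) / (?z - of_real (l k)))"
      by (metis times_divide_eq_right)
    also have "\<dots> = of_real (\<Sum>k<n. c k) - ?z * (\<Sum>k<n. of_real (c k) / (?z - of_real (l k)))"
      unfolding c_def unitary_row_norm[OF U i] by simp
    also have "\<dots> =
      (\<Sum>k<n. of_real (c k) - ?z * (of_real (c k) / (?z - of_real (l k))))"
      by (simp add: sum_subtractf sum_distrib_left)
    also have "\<dots> = (\<Sum>k<n. of_real (c k) * (of_real (l k) / (of_real (l k) - ?z)))"
    proof (intro sum.cong refl)
      fix k
      have "w - ?z * (w / (?z - of_real (l k))) = w * (of_real (l k) / (of_real (l k) - ?z))" for w
        using z[of k]
        by (simp add: divide_simps) (simp add: algebra_simps)
      then show "of_real (c k) - ?z * (of_real (c k) / (?z - of_real (l k))) =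
        of_real (c k) * (of_real (l k) / (of_real (l k) - ?z))" .
    qed
    finally show ?thesis .
  qed
  have "vertex_energy G vs i = of_real (\<Sum>k<n. c k * \<bar>l k\<bar>)"
    unfolding vertex_energy_def A_def[symmetric] mat_abs_unitary_conjugate[OF U AU]
      diag_entry_of_unitary_conjugate[OF unitary_matD(1)[OF U] i] c_def by simp
  moreover have "pv_integrable ?f" and "pv_integral ?f = of_real (pi * (\<Sum>k<n. c k * \<bar>l k\<bar>))"
    using pv_integral_sum_cauchy_kernels[of ?f c l "{..<n}"] f by auto
  ultimately show ?thesis by simp
qed

end
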